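(* Let $(A,\mu)$ be a state-morphism pseudo BCK-algebra. Then: (1) $\mu$ is injective iff ${\rm Ker}(\mu)=\{1\}$; (2) if $D$ is a deductive system of $A$ then $\mu^{-1}(D)$ is a deductive system of $A$ and ${\rm Ker}(\mu)\subseteq\mu^{-1}(D)$; (3) if $D$ is a normal deductive system of $A$ then $\mu^{-1}(D)$ is a normal deductive system of $A$; (4) if $D$ is a commutative deductive system of $A$ then $\mu^{-1}(D)$ is a commutative deductive system of $A$; (5) if $\mu$ is surjective and $D$ is a $\mu$-state deductive system of $A$, then $\mu(D)$ and $\mu(\mu(D))$ are $\mu$-state deductive systems of $A$.
   Context: A pseudo BCK-algebra is an algebra $(A,\rightarrow,\rightsquigarrow,1)$ of type $(2,2,0)$ such that for all $x,y,z\in A$: $(x\rightarrow y)\rightsquigarrow[(y\rightarrow z)\rightsquigarrow(x\rightarrow z)]=1$; $(x\rightsquigarrow y)\rightarrow[(y\rightsquigarrow z)\rightarrow(x\rightsquigarrow z)]=1$; $1\rightarrow x=x$; $1\rightsquigarrow x=x$; $x\rightarrow 1=1$; and if $x\rightarrow y=1$ and $y\rightarrow x=1$ then $x=y$. The order is $x\le y$ iff $x\rightarrow y=1$ (iff $x\rightsquigarrow y=1$). A deductive system is a subset $D$ with $1\in D$ such that $x, x\rightarrow y\in D$ imply $y\in D$; it is normal if $x\rightarrow y\in D$ iff $x\rightsquigarrow y\in D$; it is commutative if $y\rightarrow x\in D$ implies $((x\rightarrow y)\rightsquigarrow y)\rightarrow x\in D$ and $y\rightsquigarrow x\in D$ implies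 $((x\rightsquigarrow y)\rightarrow y)\rightsquigarrow x\in D$. A state-morphism operator on $A$ is a homomorphism $\mu:A\to A$ (i.e. $\mu(x\rightarrow y)=\mu(x)\rightarrow\mu(y)$, $\mu(x\rightsquigarrow y)=\mu(x)\rightsquigarrow\mu(y)$, $\mu(1)=1$) with $\mu\circ\mu=\mu$; then $(A,\mu)$ is a state-morphism pseudo BCK-algebra. ${\rm Ker}(\mu)=\{x\in A\mid\mu(x)=1\}$. A deductive system $D$ is a $\mu$-state deductive system if $\mu(D)\subseteq D$. *)

theory Defs
  imports "HOL-Algebra.Congruence"
begin

(* The arrow \<rightharpoonup> stands for the first implication of the algebra, since \<rightarrow> denotes the
   function set of HOL-Library.FuncSet. *)
record 'a pbck = "'a partial_object" +
  limp :: "'a \<Rightarrow> 'a \<Rightarrow> 'a" (infixr \<open>\<rightharpoonup>\<index>\<close> 65)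
  rimp :: "'a \<Rightarrow> 'a \<Rightarrow> 'a" (infixr \<open>\<leadsto>\<index>\<close> 65)
  pone :: 'a (\<open>\<one>\<index>\<close>)

locale pseudo_BCK_algebra =
  fixes A (structure)
  assumes limp_closed: "\<lbrakk>x \<in> carrier A; y \<in> carrier A\<rbrakk> \<Longrightarrow> x \<rightharpoonup> y \<in> carrier A"
    and rimp_closed: "\<lbrakk>x \<in> carrier A; y \<in> carrier A\<rbrakk> \<Longrightarrow> x \<leadsto> y \<in> carrier A"
    and one_closed: "\<one> \<in> carrier A"
    and limp_trans: "\<lbrakk>x \<in> carrier A; y \<in> carrier A; z \<in> carrier A\<rbrakk>
      \<Longrightarrow> (x \<rightharpoonup> y) \<leadsto> ((y \<rightharpoonup> z) \<leadsto> (x \<rightharpoonup> z)) = \<one>"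
    and rimp_trans: "\<lbrakk>x \<in> carrier A; y \<in> carrier A; z \<in> carrier A\<rbrakk>
      \<Longrightarrow> (x \<leadsto> y) \<rightharpoonup> ((y \<leadsto> z) \<rightharpoonup> (x \<leadsto> z)) = \<one>"
    and one_limp: "x \<in> carrier A \<Longrightarrow> \<one> \<rightharpoonup> x = x"
    and one_rimp: "x \<in> carrier A \<Longrightarrow> \<one> \<leadsto> x = x"
    and limp_one: "x \<in> carrier A \<Longrightarrow> x \<rightharpoonup> \<one> = \<one>"
    and limp_antisym: "\<lbrakk>x \<in> carrier A; y \<in> carrier A; x \<rightharpoonup> y = \<one>; y \<rightharpoonup> x = \<one>\<rbrakk> \<Longrightarrow> x = y"

definition deductive_system :: "('a, 'm) pbck_scheme \<Rightarrow> 'a set \<Rightarrow> bool" where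
  "deductive_system A D \<longleftrightarrow>
     D \<subseteq> carrier A \<and> \<one>\<^bsub>A\<^esub> \<in> D \<and>
     (\<forall>x\<in>carrier A. \<forall>y\<in>carrier A. x \<in> D \<longrightarrow> x \<rightharpoonup>\<^bsub>A\<^esub> y \<in> D \<longrightarrow> y \<in> D)"

definition normal_deductive_system :: "('a, 'm) pbck_scheme \<Rightarrow> 'a set \<Rightarrow> bool" where
  "normal_deductive_system A D \<longleftrightarrow>
     deductive_system A D \<and>
     (\<forall>x\<in>carrier A. \<forall>y\<in>carrier A. x \<rightharpoonup>\<^bsub>A\<^esub> y \<in> D \<longleftrightarrow> x \<leadsto>\<^bsub>A\<^esub> y \<in> D)"

definition commutative_deductive_system :: "('a, 'm) pbck_scheme \<Rightarrow> 'a set \<Rightarrow> bool" where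
  "commutative_deductive_system A D \<longleftrightarrow>
     deductive_system A D \<and>
     (\<forall>x\<in>carrier A. \<forall>y\<in>carrier A.
        (y \<rightharpoonup>\<^bsub>A\<^esub> x \<in> D \<longrightarrow> ((x \<rightharpoonup>\<^bsub>A\<^esub> y) \<leadsto>\<^bsub>A\<^esub> y) \<rightharpoonup>\<^bsub>A\<^esub> x \<in> D) \<and>
        (y \<leadsto>\<^bsub>A\<^esub> x \<in> D \<longrightarrow> ((x \<leadsto>\<^bsub>A\<^esub> y) \<rightharpoonup>\<^bsub>A\<^esub> y) \<leadsto>\<^bsub>A\<^esub> x \<in> D))"

definition pbck_hom :: "('a, 'm) pbck_scheme \<Rightarrow> ('b, 'n) pbck_scheme \<Rightarrow> ('a \<Rightarrow> 'b) set" where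
  "pbck_hom A B =
     {h \<in> carrier A \<rightarrow> carrier B.
        (\<forall>x\<in>carrier A. \<forall>y\<in>carrier A. h (x \<rightharpoonup>\<^bsub>A\<^esub> y) = h x \<rightharpoonup>\<^bsub>B\<^esub> h y) \<and>
        (\<forall>x\<in>carrier A. \<forall>y\<in>carrier A. h (x \<leadsto>\<^bsub>A\<^esub> y) = h x \<leadsto>\<^bsub>B\<^esub> h y) \<and>
        h \<one>\<^bsub>A\<^esub> = \<one>\<^bsub>B\<^esub>}"

locale state_morphism_pseudo_BCK_algebra = pseudo_BCK_algebra A for A (structure) +
  fixes \<mu>
  assumes state_hom: "\<mu> \<in> pbck_hom A A"
    and state_idem: "x \<in> carrier A \<Longrightarrow> \<mu> (\<mu> x) = \<mu> x"

definition state_Ker :: "('a, 'm) pbck_scheme \<Rightarrow> ('a \<Rightarrow> 'a) \<Rightarrow> 'a set" where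
  "state_Ker A \<mu> = {x \<in> carrier A. \<mu> x = \<one>\<^bsub>A\<^esub>}"

definition state_deductive_system ::
    "('a, 'm) pbck_scheme \<Rightarrow> ('a \<Rightarrow> 'a) \<Rightarrow> 'a set \<Rightarrow> bool" where
  "state_deductive_system A \<mu> D \<longleftrightarrow> deductive_system A D \<and> \<mu> ` D \<subseteq> D"

(* Inverse image of D under a map defined on the carrier of A; values outside the carrier
   are irrelevant. *)
definition inv_image_on :: "('a, 'm) pbck_scheme \<Rightarrow> ('a \<Rightarrow> 'b) \<Rightarrow> 'b set \<Rightarrow> 'a set" where
  "inv_image_on A \<mu> D = {x \<in> carrier A. \<mu> x \<in> D}"

end

(* The inverse-image statements hold because \<mu> commutes with both implications and fixes the
   unit. For injectivity, \<mu> x = \<mu> y puts x \<rightharpoonup> y and y \<rightharpoonup> x into the kernel, since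
   \<mu> x \<rightharpoonup> \<mu> x = \<one>; antisymmetry concludes. An idempotent surjection is the identity,
   which settles the statement on direct images. *)
theory Submission
  imports Defs
begin

text \<open>Setting the first two arguments of \<open>rimp_trans\<close> to \<open>\<one>\<close>
  gives \<open>(\<one> \<leadsto> \<one>) \<rightharpoonup> ((\<one> \<leadsto> x) \<rightharpoonup>
  (\<one> \<leadsto> x)) = \<one>\<close>, and the unit laws strip every \<open>\<one>\<close> on
  the left of an implication.\<close>

lemma (in pseudo_BCK_algebra) limp_refl:
  assumes "x \<in> carrier A"
  shows "x \<rightharpoonup> x = \<one>"
  using rimp_trans[OF one_closed one_closed assms] assms
  by (simp add: one_limp one_rimp limp_closed one_closed)

context state_morphism_pseudo_BCK_algebra
begin

lemma state_closed: "x \<in> carrier A \<Longrightarrow> \<mu> x \<in> carrier A"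
  using state_hom by (auto simp: pbck_hom_def)

lemma state_limp:
  "x \<in> carrier A \<Longrightarrow> y \<in> carrier A \<Longrightarrow> \<mu> (x \<rightharpoonup> y) = \<mu> x \<rightharpoonup> \<mu> y"
  using state_hom by (auto simp: pbck_hom_def)

lemma state_rimp:
  "x \<in> carrier A \<Longrightarrow> y \<in> carrier A \<Longrightarrow> \<mu> (x \<leadsto> y) = \<mu> x \<leadsto> \<mu> y"
  using state_hom by (auto simp: pbck_hom_def)

lemma state_one: "\<mu> \<one> = \<one>"
  using state_hom by (auto simp: pbck_hom_def)

text \<open>As rewrite rules these push \<open>\<mu>\<close> down to the variables; the closure
  facts discharge the carrier conditions that arise on nested terms.\<close>

lemmas state_simps = state_closed state_limp state_rimp state_one
  limp_closed rimp_closed one_closed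

lemma inj_on_iff_state_Ker: "inj_on \<mu> (carrier A) \<longleftrightarrow> state_Ker A \<mu> = {\<one>}"
proof
  assume "inj_on \<mu> (carrier A)"
  then show "state_Ker A \<mu> = {\<one>}"
    \<comment> \<open>A kernel element has the same image as \<open>\<one>\<close>.\<close>
    using inj_on_eq_iff[of \<mu> "carrier A" _ \<one>]
    by (auto simp: state_Ker_def one_closed state_one)
next
  assume ker: "state_Ker A \<mu> = {\<one>}"
  \<comment> \<open>The hypothesis on \<open>x\<close> and \<open>y\<close> is symmetric, so
    \<open>le\<close> supplies both premises of \<open>limp_antisym\<close>.\<close>
  have le: "x \<rightharpoonup> y = \<one>"
    if "x \<in> carrier A" "y \<in> carrier A" "\<mu> x = \<mu> y" for x y
  proof -
    have "x \<rightharpoonup> y \<in> state_Ker A \<mu>"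
      using that by (simp add: state_Ker_def state_simps limp_refl)
    then show ?thesis using ker by simp
  qed
  show "inj_on \<mu> (carrier A)"
    by (rule inj_onI, rule limp_antisym) (simp_all add: le)
qed

lemma deductive_system_inv_image:
  assumes "deductive_system A D"
  shows "deductive_system A (inv_image_on A \<mu> D)"
  unfolding deductive_system_def
proof (intro conjI ballI impI)
  show "inv_image_on A \<mu> D \<subseteq> carrier A"
    by (auto simp: inv_image_on_def)
  show "\<one> \<in> inv_image_on A \<mu> D"
    using assms by (simp add: deductive_system_def inv_image_on_def state_simps)
next
  fix x y
  assume xy: "x \<in> carrier A" "y \<in> carrier A"
    and "x \<in> inv_image_on A \<mu> D" "x \<rightharpoonup> y \<in> inv_image_on A \<mu> D"
  then have "\<mu> x \<in> D" "\<mu> x \<rightharpoonup> \<mu> y \<in> D"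
    by (simp_all add: inv_image_on_def state_limp)
  \<comment> \<open>Closure of \<open>D\<close> is quantified over the carrier and is applied here
    to the images.\<close>
  moreover have "\<mu> x \<in> carrier A" "\<mu> y \<in> carrier A"
    using xy by (simp_all add: state_closed)
  ultimately have "\<mu> y \<in> D"
    using assms unfolding deductive_system_def by blast
  then show "y \<in> inv_image_on A \<mu> D"
    using xy by (simp add: inv_image_on_def)
qed

text \<open>Kernel elements are sent to \<open>\<one>\<close>, which lies in
  \<open>D\<close>.\<close>

lemma state_Ker_subset_inv_image:
  assumes "deductive_system A D"
  shows "state_Ker A \<mu> \<subseteq> inv_image_on A \<mu> D"
  using assms by (auto simp: deductive_system_def state_Ker_def inv_image_on_def)

lemma normal_deductive_system_inv_image:
  assumes "normal_deductive_system A D"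
  shows "normal_deductive_system A (inv_image_on A \<mu> D)"
  using assms deductive_system_inv_image[of D]
  unfolding normal_deductive_system_def
  by (simp add: inv_image_on_def state_simps)

text \<open>After \<open>\<mu>\<close> is pushed inward, the condition at \<open>x\<close>,
  \<open>y\<close> is the condition on \<open>D\<close> at \<open>\<mu> x\<close>,
  \<open>\<mu> y\<close>.\<close>

lemma commutative_deductive_system_inv_image:
  assumes "commutative_deductive_system A D"
  shows "commutative_deductive_system A (inv_image_on A \<mu> D)"
  using assms deductive_system_inv_image[of D]
  unfolding commutative_deductive_system_def
  by (simp add: inv_image_on_def state_simps)

text \<open>Writing \<open>x = \<mu> y\<close>, idempotence gives
  \<open>\<mu> x = \<mu> (\<mu> y) = \<mu> y = x\<close>.\<close>

lemma surj_state_eq_id: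
  assumes "\<mu> ` carrier A = carrier A" and "x \<in> carrier A"
  shows "\<mu> x = x"
proof -
  have "x \<in> \<mu> ` carrier A" unfolding assms(1) by (fact assms(2))
  then obtain y where "y \<in> carrier A" "x = \<mu> y" by (rule imageE)
  then show ?thesis by (simp add: state_idem)
qed

lemma surj_state_image_eq:
  assumes "\<mu> ` carrier A = carrier A" and "D \<subseteq> carrier A"
  shows "\<mu> ` D = D"
proof -
  have "\<mu> x = x" if "x \<in> D" for x
    using assms(2) that by (intro surj_state_eq_id[OF assms(1)]) (rule subsetD)
  then show ?thesis by simp
qed

end

theorem theorem6p12:
  fixes A :: "('a, 'm) pbck_scheme" and \<mu> :: "'a \<Rightarrow> 'a"
  assumes "state_morphism_pseudo_BCK_algebra A \<mu>"
  shows "(inj_on \<mu> (carrier A) \<longleftrightarrow> state_Ker A \<mu> = {\<one>\<^bsub>A\<^esub>})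
    \<and> (\<forall>D. deductive_system A D \<longrightarrow>
          deductive_system A (inv_image_on A \<mu> D) \<and> state_Ker A \<mu> \<subseteq> inv_image_on A \<mu> D)
    \<and> (\<forall>D. normal_deductive_system A D \<longrightarrow>
          normal_deductive_system A (inv_image_on A \<mu> D))
    \<and> (\<forall>D. commutative_deductive_system A D \<longrightarrow>
          commutative_deductive_system A (inv_image_on A \<mu> D))
    \<and> (\<mu> ` carrier A = carrier A \<longrightarrow>
          (\<forall>D. state_deductive_system A \<mu> D \<longrightarrow>
             state_deductive_system A \<mu> (\<mu> ` D) \<and> state_deductive_system A \<mu> (\<mu> ` (\<mu> ` D))))"
proof -
  interpret state_morphism_pseudo_BCK_algebra A \<mu> by (fact assms)
  have image_eq: "\<mu> ` D = D"
    if "\<mu> ` carrier A = carrier A" "state_deductive_system A \<mu> D" for D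
  proof (rule surj_state_image_eq[OF that(1)])
    show "D \<subseteq> carrier A"
      using that(2) by (simp add: state_deductive_system_def deductive_system_def)
  qed
  show ?thesis
  proof (intro conjI allI impI)
    show "inj_on \<mu> (carrier A) \<longleftrightarrow> state_Ker A \<mu> = {\<one>\<^bsub>A\<^esub>}"
      by (fact inj_on_iff_state_Ker)
  next
    fix D
    assume "\<mu> ` carrier A = carrier A" and D: "state_deductive_system A \<mu> D"
    then have "\<mu> ` D = D" by (rule image_eq)
    \<comment> \<open>Rewriting with this equation, twice for the iterated image, reduces both
      claims to the assumption on \<open>D\<close>.\<close>
    then show "state_deductive_system A \<mu> (\<mu> ` D)"
      and "state_deductive_system A \<mu> (\<mu> ` (\<mu> ` D))"
      using D by (simp_all only:)
  qed (fact deductive_system_inv_image state_Ker_subset_inv_image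
      normal_deductive_system_inv_image commutative_deductive_system_inv_image)+
qed

end
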